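(* Let $r\in[0,T)$ and assume that the law of $(Y,C)$ solves the local martingale problem on $[r,T]$ for $(\mathcal{A}_t)_{t\in[r,T]}$ (see context). Assume that there is $K_1>0$ such that for all $(t,y,c)$ $$|\mu(t,y,c)|^2+\|\sigma(t,y,c)\sigma(t,y,c)^\top\|+\int_{\|x\|\le a}|F(t,y,c,x)|^2\,\nu(dx)\le K_1(1+|y|^2),$$ and that at least one of the following holds: (1) there is a constant $K_3$ such that for all $(t,y,c)$ $$\int_{\|x\|>a}|F(t,y,c,x)|^2\,\nu(dx)+|\rho^{c,k}(t,y)|^2\le K_3(1+|y|^2)\quad\text{for all }k\in\mathcal{K},\ k\neq c;$$ (2) there is a constant $M$ such that for all $(t,y,c)$ $$\int_{\|x\|\le1}\|F(t,y,c,x)\|^2\,\nu(dx)\le M.$$ Then the law of $(Y,C)$ solves the martingale problem on $[r,T]$ for $(\mathcal{A}_t)_{t\in[r,T]}$.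
   Context: Fix $T\in(0,\infty)$, $a>0$, positive integers $d,n,p,K$, and $\mathcal{K}=\{1,\dots,K\}$. $\nu$ is a L\'evy measure on $\mathbf{R}^n$: $\nu(\{0\})=0$, $\int(\|x\|^2\wedge1)\nu(dx)<\infty$. "Locally bounded" means bounded on compact sets. For a matrix $A$, $\|A\|^2=\sum_{i,j}|a_{i,j}|^2$. Standing assumptions on the (deterministic) coefficients: $\mu:[0,T]\times\mathbf{R}^d\times\mathcal{K}\to\mathbf{R}^d$, $\sigma:[0,T]\times\mathbf{R}^d\times\mathcal{K}\to\mathbf{R}^{d\times p}$, $\rho^{i,j}:[0,T]\times\mathbf{R}^d\to\mathbf{R}^d$ ($i\neq j$ in $\mathcal{K}$) are measurable and locally bounded; $F:[0,T]\times\mathbf{R}^d\times\mathcal{K}\times\mathbf{R}^n\to\mathbf{R}^d$ is measurable and $(t,y,c)\mapsto\int_{\|x\|\le a}|F(t,y,c,x)|^2\nu(dx)$ is locally bounded; $\lambda^{i,j}:[0,T]\times\mathbf{R}^d\to[0,\infty)$ ($i\ne j$) are bounded and continuous. $C^2_c$ is the set of compactly supported $v:\mathbf{R}^d\times\mathcal{K}\to\mathbf{R}$ with $v(\cdot,k)\in C^2(\mathbf{R}^d)$ for each $k$. For $v\in C^2_c$, $$\begin{aligned}\mathcal{A}_tv(y,c)=&\ \nabla v(y,c)\mu(t,y,c)+\tfrac12\mathrm{Tr}\big(\sigma(t,y,c)\sigma(t,y,c)^\top\nabla^2v(y,c)\big)\\&+\int_{\mathbf{R}^n}\big(v(y+F(t,y,c,x),c)-v(y,c)-\nabla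 v(y,c)F(t,y,c,x)\mathbf{1}_{\{\|x\|\le a\}}\big)\nu(dx)\\&+\sum_{k\in\mathcal{K}\setminus\{c\}}\big(v(y+\rho^{c,k}(t,y),k)-v(y,c)\big)\lambda^{c,k}(t,y),\end{aligned}$$ with derivatives in $y$. The law of a c\`adl\`ag $\mathbf{R}^d\times\mathcal{K}$-valued process $(Y,C)$ solves the (local) martingale problem on $[r,T]$ for $(\mathcal{A}_t)_{t\in[r,T]}$ if for every $v\in C^2_c$ the process $M^v_t=v(Y_t,C_t)-\int_r^t\mathcal{A}_uv(Y_{u-},C_{u-})du$ is a (local) martingale on $[r,T]$ with respect to the filtration generated by $(Y,C)$ on $[r,T]$. *)

theory Defs
  imports "HOL-Probability.Probability"
begin

section \<open>Test functions and their derivatives\<close>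

definition grad :: "(real ^ 'd \<Rightarrow> real) \<Rightarrow> real ^ 'd \<Rightarrow> real ^ 'd" where
  "grad f y = (\<chi> i. frechet_derivative f (at y) (axis i 1))"

definition hess :: "(real ^ 'd \<Rightarrow> real) \<Rightarrow> real ^ 'd \<Rightarrow> real ^ 'd ^ 'd" where
  "hess f y = (\<chi> i j. grad (\<lambda>z. grad f z $ j) y $ i)"

definition C2 :: "(real ^ 'd \<Rightarrow> real) \<Rightarrow> bool" where
  "C2 f \<longleftrightarrow> f differentiable_on UNIV \<and> grad f differentiable_on UNIV
     \<and> continuous_on UNIV (hess f)"

text \<open>The finite regime set is \<open>{1..K}\<close>, as a set of natural numbers with their discrete topology.
  Functions of the regime are total on \<open>nat\<close>; only their values on \<open>{1..K}\<close> matter.\<close>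

definition C2c :: "nat \<Rightarrow> (real ^ 'd \<Rightarrow> nat \<Rightarrow> real) set" where
  "C2c K = {v. compact (closure {(y, c). c \<in> {1..K} \<and> v y c \<noteq> 0})
              \<and> (\<forall>k\<in>{1..K}. C2 (\<lambda>y. v y k))}"

section \<open>Coefficients and generator\<close>

definition levy_measure :: "(real ^ 'n) measure \<Rightarrow> bool" where
  "levy_measure \<nu> \<longleftrightarrow> sets \<nu> = sets borel \<and> emeasure \<nu> {0} = 0
     \<and> (\<integral>\<^sup>+x. ennreal (min ((norm x)\<^sup>2) 1) \<partial>\<nu>) < \<infinity>"

definition locally_bounded_on ::
    "'a::topological_space set \<Rightarrow> ('a \<Rightarrow> 'b::real_normed_vector) \<Rightarrow> bool" where
  "locally_bounded_on D f \<longleftrightarrow> (\<forall>S\<subseteq>D. compact S \<longrightarrow> bounded (f ` S))"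

text \<open>Integrals that are assumed to be bounded are written as nonnegative integrals with values in
  \<open>ennreal\<close>, so that a bound entails finiteness; the Bochner integral of a
  nonintegrable function would be \<open>0\<close>. The norm on \<open>real ^ 'p ^ 'd\<close> is the Frobenius norm.\<close>

locale switching_coefficients =
  fixes T a :: real
    and K :: nat
    and \<nu> :: "(real ^ 'n) measure"
    and \<mu> :: "real \<Rightarrow> real ^ 'd \<Rightarrow> nat \<Rightarrow> real ^ 'd"
    and \<sigma> :: "real \<Rightarrow> real ^ 'd \<Rightarrow> nat \<Rightarrow> real ^ 'p ^ 'd"
    and F :: "real \<Rightarrow> real ^ 'd \<Rightarrow> nat \<Rightarrow> real ^ 'n \<Rightarrow> real ^ 'd"
    and \<rho> :: "nat \<Rightarrow> nat \<Rightarrow> real \<Rightarrow> real ^ 'd \<Rightarrow> real ^ 'd"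
    and lam :: "nat \<Rightarrow> nat \<Rightarrow> real \<Rightarrow> real ^ 'd \<Rightarrow> real"
  assumes T_pos: "T > 0" and a_pos: "a > 0" and K_pos: "K \<ge> 1"
    and levy: "levy_measure \<nu>"
    and mu_measurable:
      "(\<lambda>(t, y, c). \<mu> t y c) \<in> borel_measurable (restrict_space borel ({0..T} \<times> UNIV \<times> {1..K}))"
    and mu_bounded: "locally_bounded_on ({0..T} \<times> UNIV \<times> {1..K}) (\<lambda>(t, y, c). \<mu> t y c)"
    and sigma_measurable:
      "(\<lambda>(t, y, c). \<sigma> t y c) \<in> borel_measurable (restrict_space borel ({0..T} \<times> UNIV \<times> {1..K}))"
    and sigma_bounded: "locally_bounded_on ({0..T} \<times> UNIV \<times> {1..K}) (\<lambda>(t, y, c). \<sigma> t y c)"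
    and rho_measurable: "\<And>i j. i \<in> {1..K} \<Longrightarrow> j \<in> {1..K} \<Longrightarrow> i \<noteq> j \<Longrightarrow>
      (\<lambda>(t, y). \<rho> i j t y) \<in> borel_measurable (restrict_space borel ({0..T} \<times> UNIV))"
    and rho_bounded: "\<And>i j. i \<in> {1..K} \<Longrightarrow> j \<in> {1..K} \<Longrightarrow> i \<noteq> j \<Longrightarrow>
      locally_bounded_on ({0..T} \<times> UNIV) (\<lambda>(t, y). \<rho> i j t y)"
    and F_measurable:
      "(\<lambda>(t, y, c, x). F t y c x)
         \<in> borel_measurable (restrict_space borel ({0..T} \<times> UNIV \<times> {1..K} \<times> UNIV))"
    and F_bounded: "\<And>S. S \<subseteq> {0..T} \<times> UNIV \<times> {1..K} \<Longrightarrow> compact S \<Longrightarrow>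
      (\<Squnion>(t, y, c)\<in>S. \<integral>\<^sup>+x\<in>{x. norm x \<le> a}. ennreal ((norm (F t y c x))\<^sup>2) \<partial>\<nu>) < \<infinity>"
    and lam_nonneg: "\<And>i j t y. i \<in> {1..K} \<Longrightarrow> j \<in> {1..K} \<Longrightarrow> i \<noteq> j \<Longrightarrow> t \<in> {0..T} \<Longrightarrow>
      lam i j t y \<ge> 0"
    and lam_bounded: "\<And>i j. i \<in> {1..K} \<Longrightarrow> j \<in> {1..K} \<Longrightarrow> i \<noteq> j \<Longrightarrow>
      bounded ((\<lambda>(t, y). lam i j t y) ` ({0..T} \<times> UNIV))"
    and lam_continuous: "\<And>i j. i \<in> {1..K} \<Longrightarrow> j \<in> {1..K} \<Longrightarrow> i \<noteq> j \<Longrightarrow>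
      continuous_on ({0..T} \<times> UNIV) (\<lambda>(t, y). lam i j t y)"

definition generator ::
    "real \<Rightarrow> nat \<Rightarrow> (real ^ 'n) measure
     \<Rightarrow> (real \<Rightarrow> real ^ 'd \<Rightarrow> nat \<Rightarrow> real ^ 'd)
     \<Rightarrow> (real \<Rightarrow> real ^ 'd \<Rightarrow> nat \<Rightarrow> real ^ 'p ^ 'd)
     \<Rightarrow> (real \<Rightarrow> real ^ 'd \<Rightarrow> nat \<Rightarrow> real ^ 'n \<Rightarrow> real ^ 'd)
     \<Rightarrow> (nat \<Rightarrow> nat \<Rightarrow> real \<Rightarrow> real ^ 'd \<Rightarrow> real ^ 'd)
     \<Rightarrow> (nat \<Rightarrow> nat \<Rightarrow> real \<Rightarrow> real ^ 'd \<Rightarrow> real)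
     \<Rightarrow> real \<Rightarrow> (real ^ 'd \<Rightarrow> nat \<Rightarrow> real) \<Rightarrow> real ^ 'd \<Rightarrow> nat \<Rightarrow> real" where
  "generator a K \<nu> \<mu> \<sigma> F \<rho> lam t v y c =
     grad (\<lambda>z. v z c) y \<bullet> \<mu> t y c
     + 1 / 2 * trace (\<sigma> t y c ** transpose (\<sigma> t y c) ** hess (\<lambda>z. v z c) y)
     + (\<integral>x. (v (y + F t y c x) c - v y c
              - (grad (\<lambda>z. v z c) y \<bullet> F t y c x) * indicator {x. norm x \<le> a} x) \<partial>\<nu>)
     + (\<Sum>k\<in>{1..K} - {c}. (v (y + \<rho> c k t y) k - v y c) * lam c k t y)"

section \<open>Processes on a compact time interval\<close>

definition cadlag_on :: "real \<Rightarrow> real \<Rightarrow> (real \<Rightarrow> 'a::topological_space) \<Rightarrow> bool" where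
  "cadlag_on r T f \<longleftrightarrow>
     (\<forall>t\<in>{r..<T}. (f \<longlongrightarrow> f t) (at_right t)) \<and> (\<forall>t\<in>{r<..T}. \<exists>l. (f \<longlongrightarrow> l) (at_left t))"

definition cadlag_process ::
    "'w measure \<Rightarrow> real \<Rightarrow> real \<Rightarrow> nat \<Rightarrow> (real \<Rightarrow> 'w \<Rightarrow> real ^ 'd) \<Rightarrow> (real \<Rightarrow> 'w \<Rightarrow> nat) \<Rightarrow> bool" where
  "cadlag_process P r T K Y C \<longleftrightarrow>
     (\<forall>t\<in>{r..T}. Y t \<in> measurable P borel \<and> C t \<in> measurable P (count_space UNIV)
        \<and> (\<forall>\<omega>\<in>space P. C t \<omega> \<in> {1..K}))
     \<and> (\<forall>\<omega>\<in>space P. cadlag_on r T (\<lambda>t. (Y t \<omega>, C t \<omega>)))"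

text \<open>Only the family of \<open>\<sigma>\<close>-algebras matters here; the measure carried by \<open>sigma\<close> is null and is not
  used by \<open>real_cond_exp\<close> or \<open>stopping_time\<close>.\<close>

definition generated_filtration ::
    "'w measure \<Rightarrow> real \<Rightarrow> (real \<Rightarrow> 'w \<Rightarrow> 'a::topological_space) \<Rightarrow> real \<Rightarrow> 'w measure" where
  "generated_filtration P r Z t =
     sigma (space P) {Z u -` A \<inter> space P | u A. u \<in> {r..t} \<and> A \<in> sets borel}"

definition martingale_on ::
    "'w measure \<Rightarrow> (real \<Rightarrow> 'w measure) \<Rightarrow> real \<Rightarrow> real \<Rightarrow> (real \<Rightarrow> 'w \<Rightarrow> real) \<Rightarrow> bool" where
  "martingale_on P G r T X \<longleftrightarrow>
     (\<forall>t\<in>{r..T}. X t \<in> borel_measurable (G t) \<and> integrable P (X t))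
     \<and> (\<forall>s\<in>{r..T}. \<forall>t\<in>{s..T}. AE \<omega> in P. real_cond_exp P (G s) (X t) \<omega> = X s \<omega>)"

text \<open>On the compact interval \<open>{r..T}\<close> a localizing sequence has to reach \<open>T\<close> after finitely many
  steps almost surely: convergence to \<open>T\<close> alone would only localize on \<open>{r..<T}\<close>.\<close>

definition local_martingale_on ::
    "'w measure \<Rightarrow> (real \<Rightarrow> 'w measure) \<Rightarrow> real \<Rightarrow> real \<Rightarrow> (real \<Rightarrow> 'w \<Rightarrow> real) \<Rightarrow> bool" where
  "local_martingale_on P G r T X \<longleftrightarrow>
     (\<forall>t\<in>{r..T}. X t \<in> borel_measurable (G t))
     \<and> (\<exists>\<tau> :: nat \<Rightarrow> 'w \<Rightarrow> real.
          (\<forall>n. stopping_time G (\<tau> n) \<and> (\<forall>\<omega>\<in>space P. \<tau> n \<omega> \<in> {r..T}))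
          \<and> (AE \<omega> in P. incseq (\<lambda>n. \<tau> n \<omega>))
          \<and> (AE \<omega> in P. \<exists>n. \<tau> n \<omega> = T)
          \<and> (\<forall>n. martingale_on P G r T (\<lambda>t \<omega>. X (min (\<tau> n \<omega>) t) \<omega>)))"

section \<open>Martingale problems\<close>

definition left_limit :: "(real \<Rightarrow> 'a::t2_space) \<Rightarrow> real \<Rightarrow> 'a" where
  "left_limit f t = Lim (at_left t) f"

text \<open>The left limit at the single time \<open>u = r\<close> is irrelevant to the integral.\<close>

definition test_process ::
    "(real \<Rightarrow> (real ^ 'd \<Rightarrow> nat \<Rightarrow> real) \<Rightarrow> real ^ 'd \<Rightarrow> nat \<Rightarrow> real)
     \<Rightarrow> real \<Rightarrow> (real \<Rightarrow> 'w \<Rightarrow> real ^ 'd) \<Rightarrow> (real \<Rightarrow> 'w \<Rightarrow> nat)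
     \<Rightarrow> (real ^ 'd \<Rightarrow> nat \<Rightarrow> real) \<Rightarrow> real \<Rightarrow> 'w \<Rightarrow> real" where
  "test_process \<A> r Y C v t \<omega> =
     v (Y t \<omega>) (C t \<omega>)
     - (LINT u:{r..t}|lborel. \<A> u v (left_limit (\<lambda>s. Y s \<omega>) u) (left_limit (\<lambda>s. C s \<omega>) u))"

definition solves_martingale_problem ::
    "nat \<Rightarrow> (real \<Rightarrow> (real ^ 'd \<Rightarrow> nat \<Rightarrow> real) \<Rightarrow> real ^ 'd \<Rightarrow> nat \<Rightarrow> real)
     \<Rightarrow> 'w measure \<Rightarrow> real \<Rightarrow> real \<Rightarrow> (real \<Rightarrow> 'w \<Rightarrow> real ^ 'd) \<Rightarrow> (real \<Rightarrow> 'w \<Rightarrow> nat) \<Rightarrow> bool" where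
  "solves_martingale_problem K \<A> P r T Y C \<longleftrightarrow>
     (\<forall>v\<in>C2c K. martingale_on P (generated_filtration P r (\<lambda>t \<omega>. (Y t \<omega>, C t \<omega>))) r T
        (test_process \<A> r Y C v))"

definition solves_local_martingale_problem ::
    "nat \<Rightarrow> (real \<Rightarrow> (real ^ 'd \<Rightarrow> nat \<Rightarrow> real) \<Rightarrow> real ^ 'd \<Rightarrow> nat \<Rightarrow> real)
     \<Rightarrow> 'w measure \<Rightarrow> real \<Rightarrow> real \<Rightarrow> (real \<Rightarrow> 'w \<Rightarrow> real ^ 'd) \<Rightarrow> (real \<Rightarrow> 'w \<Rightarrow> nat) \<Rightarrow> bool" where
  "solves_local_martingale_problem K \<A> P r T Y C \<longleftrightarrow>
     (\<forall>v\<in>C2c K. local_martingale_on P (generated_filtration P r (\<lambda>t \<omega>. (Y t \<omega>, C t \<omega>))) r T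
        (test_process \<A> r Y C v))"

end

theory Submission
  imports Defs
begin

text \<open>The growth bound on \<open>\<mu>\<close>, \<open>\<sigma>\<close> and the small jumps makes \<open>(t, y, c) \<mapsto> \<A>\<^sub>t v(y, c)\<close>
  bounded for every \<open>v\<close> in \<open>C\<^sup>2\<^sub>c\<close>: the local terms vanish off the support of \<open>v\<close>, large jumps
  have finite intensity, switching has bounded intensity, and small jumps that return to the
  support from a distant \<open>y\<close> have size of order \<open>norm y\<close>, hence bounded intensity by Chebyshev's
  inequality. On a bounded time interval the local martingale \<open>M\<^sup>v\<close> is therefore bounded, and
  dominated convergence along a localizing sequence makes it a martingale.\<close>

section \<open>Differential calculus of \<open>C2\<close> functions\<close>

text \<open>The derivative is linear, hence determined by its values on the axis vectors, and these
  are the entries of \<open>grad\<close>.\<close>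

lemma has_derivative_grad:
  fixes f :: "real ^ 'd \<Rightarrow> real"
  assumes "f differentiable (at y)"
  shows "(f has_derivative (\<lambda>h. grad f y \<bullet> h)) (at y)"
proof -
  have D: "(f has_derivative frechet_derivative f (at y)) (at y)"
    using assms by (simp add: frechet_derivative_works)
  have "frechet_derivative f (at y) h = grad f y \<bullet> h" for h
  proof -
    have "frechet_derivative f (at y) h
        = frechet_derivative f (at y) (\<Sum>i\<in>UNIV. h $ i *\<^sub>R axis i 1)"
      by (simp add: basis_expansion flip: scalar_mult_eq_scaleR)
    also have "\<dots> = (\<Sum>i\<in>UNIV. h $ i * frechet_derivative f (at y) (axis i 1))"
      using has_derivative_linear[OF D] by (simp add: linear_sum linear_cmul)
    finally show ?thesis
      by (simp add: grad_def inner_vec_def mult.commute)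
  qed
  then have "frechet_derivative f (at y) = (\<lambda>h. grad f y \<bullet> h)" by auto
  with D show ?thesis by simp
qed

lemma grad_eq_0:
  assumes "open S" "y \<in> S" "\<And>z. z \<in> S \<Longrightarrow> f z = 0"
  shows "grad f y = 0"
proof -
  have "(f has_derivative (\<lambda>_. 0)) (at y)"
    by (rule has_derivative_transform_within_open[OF has_derivative_const[of 0] assms(1,2)])
      (simp add: assms(3))
  then have "frechet_derivative f (at y) = (\<lambda>_. 0)"
    by (metis frechet_derivative_at)
  then show ?thesis by (simp add: grad_def vec_eq_iff)
qed

lemma hess_eq_0:
  assumes "open S" "y \<in> S" "\<And>z. z \<in> S \<Longrightarrow> f z = 0"
  shows "hess f y = 0"
proof -
  have "grad (\<lambda>z. grad f z $ j) y = 0" for j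
    by (rule grad_eq_0[OF assms(1,2)]) (simp add: grad_eq_0[OF assms(1) _ assms(3)])
  then show ?thesis by (simp add: hess_def vec_eq_iff)
qed

lemma abs_matrix_entry_le:
  fixes M :: "real ^ 'n ^ 'm"
  shows "\<bar>M $ i $ j\<bar> \<le> norm M"
  using component_le_norm_cart[of "M $ i" j] Finite_Cartesian_Product.norm_nth_le[of M i]
  by linarith

text \<open>Mean value inequality for the vector field \<open>grad f\<close>, whose derivative is
  made of the entries of \<open>hess f\<close>. One factor \<open>CARD('d)\<close> comes from the
  sum inside each component, the other from bounding the Euclidean norm by the sum of the
  components. The constant is crude, but only its independence of the point matters.\<close>

lemma grad_lipschitz:
  fixes f :: "real ^ 'd \<Rightarrow> real" and B :: real
  assumes "C2 f" and B: "\<And>z. norm (hess f z) \<le> B"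
  shows "norm (grad f x - grad f y) \<le> CARD('d) * (CARD('d) * B) * norm (x - y)"
proof -
  let ?D = "\<lambda>z h. \<chi> j. grad (\<lambda>w. grad f w $ j) z \<bullet> h"
  have diff: "grad f differentiable (at z)" for z
    using assms(1) by (simp add: C2_def differentiable_on_def)
  have D: "(grad f has_derivative ?D z) (at z)" for z
  proof -
    from diff obtain D where D: "(grad f has_derivative D) (at z)"
      by (auto simp: differentiable_def)
    \<comment> \<open>\<open>C2\<close> only provides some derivative \<open>D\<close> of
      \<open>grad f\<close>. Uniqueness of derivatives, applied to each component, identifies it
      with the partial derivatives that make up \<open>hess\<close>.\<close>
    have "D h = ?D z h" for h
    proof (rule vec_eq_iff[THEN iffD2], intro allI)
      fix j
      have "((\<lambda>w. grad f w $ j) has_derivative (\<lambda>h. D h $ j)) (at z)"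
        by (rule bounded_linear.has_derivative[OF bounded_linear_vec_nth D])
      moreover from this
      have "((\<lambda>w. grad f w $ j) has_derivative (\<lambda>h. grad (\<lambda>w. grad f w $ j) z \<bullet> h)) (at z)"
        by (intro has_derivative_grad) (auto simp: differentiable_def)
      ultimately have "(\<lambda>h. D h $ j) = (\<lambda>h. grad (\<lambda>w. grad f w $ j) z \<bullet> h)"
        by (rule has_derivative_unique)
      from fun_cong[OF this, of h] show "D h $ j = ?D z h $ j" by simp
    qed
    then have "D = ?D z" by (rule ext)
    with D show ?thesis by simp
  qed
  have "norm (?D z h) \<le> CARD('d) * (CARD('d) * B) * norm h" for z h
  proof -
    have entry: "\<bar>hess f z $ i $ j\<bar> \<le> B" for i j
      using abs_matrix_entry_le B order_trans by blast
    have "\<bar>?D z h $ j\<bar> \<le> CARD('d) * B * norm h" for j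
    proof -
      have "?D z h $ j = (\<Sum>i\<in>UNIV. hess f z $ i $ j * h $ i)"
        by (simp add: hess_def inner_vec_def)
      also have "\<bar>\<dots>\<bar> \<le> (\<Sum>i\<in>(UNIV::'d set). B * norm h)"
        by (intro order.trans[OF sum_abs] sum_mono)
          (auto simp: abs_mult intro!: mult_mono entry component_le_norm_cart
            order.trans[OF abs_ge_zero entry])
      finally show ?thesis by (simp add: mult.assoc)
    qed
    then have "(\<Sum>j\<in>UNIV. \<bar>?D z h $ j\<bar>) \<le> (\<Sum>j\<in>(UNIV::'d set). CARD('d) * B * norm h)"
      by (intro sum_mono)
    with norm_le_l1_cart[of "?D z h"] show ?thesis by (simp add: algebra_simps)
  qed
  then have "onorm (?D z) \<le> CARD('d) * (CARD('d) * B)" for z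
    by (rule onorm_le)
  then show ?thesis
    using D by (intro differentiable_bound[of UNIV]) auto
qed

text \<open>The mean value theorem along the segment from \<open>y\<close> to \<open>y + h\<close>
  leaves a difference of gradients, and \<open>grad_lipschitz\<close> gives the second factor
  \<open>norm h\<close>. It makes the compensated small-jump integrand quadratic in the jump,
  uniformly in \<open>y\<close>.\<close>

lemma second_order_remainder:
  fixes f :: "real ^ 'd \<Rightarrow> real" and B :: real
  assumes "C2 f" and B: "\<And>z. norm (hess f z) \<le> B"
  shows "\<bar>f (y + h) - f y - grad f y \<bullet> h\<bar> \<le> CARD('d) * (CARD('d) * B) * (norm h)\<^sup>2"
proof -
  define L where "L = CARD('d) * (CARD('d) * B)"
  have "B \<ge> 0" using B[of 0] norm_ge_zero order_trans by blast
  then have "L \<ge> 0" by (simp add: L_def)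
  have D: "(f has_derivative (\<lambda>h. grad f z \<bullet> h)) (at z)" for z
    using assms(1) by (intro has_derivative_grad) (simp add: C2_def differentiable_on_def)
  have "((\<lambda>s. f (y + s *\<^sub>R h)) has_real_derivative grad f (y + s *\<^sub>R h) \<bullet> h) (at s)" for s
    unfolding has_field_derivative_def
    by (rule has_derivative_eq_rhs[OF has_derivative_compose[OF _ D]])
      (auto intro!: derivative_eq_intros)
  then obtain s where s: "0 < s" "s < 1"
      and eq: "f (y + 1 *\<^sub>R h) - f (y + 0 *\<^sub>R h) = (1 - 0) * (grad f (y + s *\<^sub>R h) \<bullet> h)"
    using MVT2[of 0 1 "\<lambda>s. f (y + s *\<^sub>R h)" "\<lambda>s. grad f (y + s *\<^sub>R h) \<bullet> h"] by auto
  have "f (y + h) - f y - grad f y \<bullet> h = (grad f (y + s *\<^sub>R h) - grad f y) \<bullet> h"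
    using eq by (simp add: inner_diff_left)
  also have "\<bar>\<dots>\<bar> \<le> norm (grad f (y + s *\<^sub>R h) - grad f y) * norm h"
    by (rule Cauchy_Schwarz_ineq2)
  also have "\<dots> \<le> (L * norm (s *\<^sub>R h)) * norm h"
    using grad_lipschitz[OF assms, of "y + s *\<^sub>R h" y]
    by (intro mult_right_mono) (simp_all add: L_def)
  also have "\<dots> \<le> (L * norm h) * norm h"
    using s \<open>L \<ge> 0\<close> by (intro mult_right_mono mult_left_mono) (auto simp: mult_left_le_one_le)
  finally show ?thesis by (simp add: L_def power2_eq_square mult.assoc)
qed

text \<open>The trace of a product is a sum of \<open>CARD('d)\<close> times \<open>CARD('d)\<close>
  products of entries. It serves the diffusion term.\<close>

lemma abs_trace_mult_le:
  fixes A H :: "real ^ 'd ^ 'd"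
  shows "\<bar>trace (A ** H)\<bar> \<le> CARD('d) * (CARD('d) * (norm A * norm H))"
proof -
  have "trace (A ** H) = (\<Sum>i\<in>UNIV. \<Sum>j\<in>UNIV. A $ i $ j * H $ j $ i)"
    by (simp add: trace_def matrix_matrix_mult_def)
  also have "\<bar>\<dots>\<bar> \<le> (\<Sum>i\<in>(UNIV::'d set). \<Sum>j\<in>(UNIV::'d set). norm A * norm H)"
    by (intro order.trans[OF sum_abs] sum_mono) (auto simp: abs_mult intro!: mult_mono abs_matrix_entry_le)
  finally show ?thesis by simp
qed

section \<open>Uniform bounds for test functions\<close>

lemma continuous_zero_outside_cball_bounded:
  fixes g :: "'a::euclidean_space \<Rightarrow> 'b::real_normed_vector"
  assumes "continuous_on UNIV g" and zero: "\<And>y. norm y > R \<Longrightarrow> g y = 0"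
  obtains V where "\<And>y. norm (g y) \<le> V"
proof -
  have "compact (g ` cball 0 R)"
    using assms(1) by (intro compact_continuous_image) (auto intro: continuous_on_subset)
  then obtain V where V: "\<And>y. norm y \<le> R \<Longrightarrow> norm (g y) \<le> V"
    using compact_imp_bounded[of "g ` cball 0 R"]
    by (metis bounded_iff imageI mem_cball_0)
  \<comment> \<open>For negative \<open>R\<close> the ball is empty and \<open>V\<close> may be
    negative, hence the maximum with \<open>0\<close>.\<close>
  have "norm (g y) \<le> max V 0" for y
    using V[of y] zero[of y] by (cases "norm y \<le> R") auto
  then show thesis by (rule that)
qed

text \<open>The projection of the compact support to the space variable is bounded, which yields
  \<open>R\<close>. Beyond \<open>R\<close> lies an open set on which \<open>v\<close> vanishes, so
  its derivatives vanish there too. Since there are finitely many regimes, one constant serves them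
  all.\<close>

lemma C2c_bounds:
  fixes v :: "real ^ 'd \<Rightarrow> nat \<Rightarrow> real"
  assumes "v \<in> C2c K"
  obtains R V where "R \<ge> 0" "V \<ge> 0"
    and "\<And>k. k \<in> {1..K} \<Longrightarrow> C2 (\<lambda>z. v z k)"
    and "\<And>k y. k \<in> {1..K} \<Longrightarrow> \<bar>v y k\<bar> \<le> V"
    and "\<And>k y. k \<in> {1..K} \<Longrightarrow> norm (grad (\<lambda>z. v z k) y) \<le> V"
    and "\<And>k y. k \<in> {1..K} \<Longrightarrow> norm (hess (\<lambda>z. v z k) y) \<le> V"
    and "\<And>k y. k \<in> {1..K} \<Longrightarrow> norm y > R \<Longrightarrow>
      v y k = 0 \<and> grad (\<lambda>z. v z k) y = 0 \<and> hess (\<lambda>z. v z k) y = 0"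
proof -
  let ?S = "{(y, c). c \<in> {1..K} \<and> v y c \<noteq> 0}"
  have C2: "C2 (\<lambda>z. v z k)" if "k \<in> {1..K}" for k
    using assms that by (simp add: C2c_def)
  have "bounded (fst ` closure ?S)"
    using assms by (intro compact_imp_bounded compact_continuous_image)
      (auto simp: C2c_def intro!: continuous_intros)
  then obtain R0 where R0: "\<And>z. z \<in> fst ` closure ?S \<Longrightarrow> norm z \<le> R0"
    by (auto simp: bounded_iff)
  define R where "R = max R0 0"
  have v0: "v y k = 0" if "k \<in> {1..K}" "norm y > R" for y k
  proof (rule ccontr)
    assume "v y k \<noteq> 0"
    then have "(y, k) \<in> closure ?S"
      using that(1) closure_subset[of ?S] by auto
    then have "y \<in> fst ` closure ?S" by force
    with R0[of y] that(2) show False by (auto simp: R_def)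
  qed
  have op: "open {y :: real ^ 'd. norm y > R}"
    by (intro open_Collect_less continuous_intros)
  have g0: "grad (\<lambda>z. v z k) y = 0" "hess (\<lambda>z. v z k) y = 0"
    if "k \<in> {1..K}" "norm y > R" for y k
    using that v0 by (auto intro!: grad_eq_0[OF op] hess_eq_0[OF op])
  have "\<exists>V. \<forall>y. \<bar>v y k\<bar> \<le> V \<and> norm (grad (\<lambda>z. v z k) y) \<le> V \<and> norm (hess (\<lambda>z. v z k) y) \<le> V"
    if k: "k \<in> {1..K}" for k
  proof -
    have c: "continuous_on UNIV (\<lambda>z. v z k)" "continuous_on UNIV (grad (\<lambda>z. v z k))"
        "continuous_on UNIV (hess (\<lambda>z. v z k))"
      using C2[OF k] by (auto simp: C2_def intro: differentiable_imp_continuous_on)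
    obtain V1 V2 V3 where "\<And>y. norm (v y k) \<le> V1" "\<And>y. norm (grad (\<lambda>z. v z k) y) \<le> V2"
        "\<And>y. norm (hess (\<lambda>z. v z k) y) \<le> V3"
      using continuous_zero_outside_cball_bounded[OF c(1) v0[OF k]]
        continuous_zero_outside_cball_bounded[OF c(2) g0(1)[OF k]]
        continuous_zero_outside_cball_bounded[OF c(3) g0(2)[OF k]] by metis
    then show ?thesis by (intro exI[of _ "max V1 (max V2 V3)"]) (auto simp: le_max_iff_disj)
  qed
  then obtain V where V: "\<And>k y. k \<in> {1..K} \<Longrightarrow> \<bar>v y k\<bar> \<le> V k \<and>
      norm (grad (\<lambda>z. v z k) y) \<le> V k \<and> norm (hess (\<lambda>z. v z k) y) \<le> V k"
    by metis
  define W where "W = (\<Sum>k\<in>{1..K}. \<bar>V k\<bar>)"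
  have W: "V k \<le> W" if "k \<in> {1..K}" for k
    using member_le_sum[of k "{1..K}" "\<lambda>k. \<bar>V k\<bar>"] that by (auto simp: W_def)
  show thesis
  proof (rule that[of R W])
    show "R \<ge> 0" "W \<ge> 0" by (auto simp: R_def W_def intro: sum_nonneg)
  qed (use C2 V W v0 g0 order_trans in blast)+
qed

section \<open>Levy measures and norms of integrals\<close>

text \<open>Chebyshev's inequality: on this set the integrand of the Levy condition is at least
  \<open>min (a\<^sup>2) 1\<close>, which is positive.\<close>

lemma levy_measure_large_jumps:
  fixes \<nu> :: "(real ^ 'n) measure"
  assumes "levy_measure \<nu>" "a > 0"
  shows "emeasure \<nu> {x. norm x > a} < \<infinity>"
proof -
  have sets[measurable_cong]: "sets \<nu> = sets borel"
    and fin: "(\<integral>\<^sup>+x. ennreal (min ((norm x)\<^sup>2) 1) \<partial>\<nu>) < \<infinity>"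
    using assms by (auto simp: levy_measure_def)
  define m where "m = min (a\<^sup>2) 1"
  have m: "m > 0" using assms by (simp add: m_def)
  have meas: "{x. norm x > a} \<in> sets \<nu>" unfolding sets by measurable
  have "ennreal m * emeasure \<nu> {x. norm x > a} = (\<integral>\<^sup>+x. ennreal m * indicator {x. norm x > a} x \<partial>\<nu>)"
    using meas by (simp add: nn_integral_cmult_indicator)
  also have "\<dots> \<le> (\<integral>\<^sup>+x. ennreal (min ((norm x)\<^sup>2) 1) \<partial>\<nu>)"
  proof (rule nn_integral_mono)
    fix x :: "real ^ 'n"
    have "m \<le> min ((norm x)\<^sup>2) 1" if "norm x > a"
      using power_mono[of a "norm x" 2] that assms by (simp add: m_def min.coboundedI1)
    then show "ennreal m * indicator {x. norm x > a} x \<le> ennreal (min ((norm x)\<^sup>2) 1)"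
      by (auto simp: indicator_def intro: ennreal_leI)
  qed
  finally have "ennreal m * emeasure \<nu> {x. norm x > a} < \<infinity>" using fin by (rule le_less_trans)
  with m show ?thesis by (auto simp: ennreal_mult_less_top less_top)
qed

text \<open>The Bochner integral of a nonintegrable function is \<open>0\<close>, so in that case
  the bound holds through \<open>B \<ge> 0\<close>. Applications therefore only have to dominate the
  integrand, without first proving it measurable.\<close>

lemma norm_integral_le:
  fixes f :: "'a \<Rightarrow> 'b::{banach, second_countable_topology}"
  assumes "AE x in M. ennreal (norm (f x)) \<le> g x" and "(\<integral>\<^sup>+x. g x \<partial>M) \<le> ennreal B" "B \<ge> 0"
  shows "norm (\<integral>x. f x \<partial>M) \<le> B"
proof (cases "integrable M f")
  case True
  have "ennreal (norm (\<integral>x. f x \<partial>M)) \<le> (\<integral>\<^sup>+x. ennreal (norm (f x)) \<partial>M)"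
    by (rule integral_norm_bound_ennreal[OF True])
  also have "\<dots> \<le> (\<integral>\<^sup>+x. g x \<partial>M)" by (rule nn_integral_mono_AE[OF assms(1)])
  finally have "ennreal (norm (\<integral>x. f x \<partial>M)) \<le> ennreal B" using assms(2) by order
  then show ?thesis using assms(3) by simp
next
  case False
  then show ?thesis using assms(3) by (simp add: not_integrable_integral_eq)
qed

section \<open>Bounded local martingales\<close>

text \<open>Conditional expectations are characterised by integrals over the sets of
  \<open>G s\<close>. These integrals agree for the stopped processes and pass to the limit by
  dominated convergence. The localizing times eventually equal \<open>T\<close>, so the stopped
  values are eventually equal to \<open>X t\<close>, whatever the paths look like.\<close>

lemma bounded_local_martingale_imp_martingale:
  assumes "prob_space P"
    and sub: "\<And>t. t \<in> {r..T} \<Longrightarrow> subalgebra P (G t)"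
    and loc: "local_martingale_on P G r T X"
    and bd: "\<And>t \<omega>. t \<in> {r..T} \<Longrightarrow> \<omega> \<in> space P \<Longrightarrow> \<bar>X t \<omega>\<bar> \<le> B"
  shows "martingale_on P G r T X"
proof -
  interpret prob_space P by fact
  obtain \<tau> where \<tau>: "\<And>n \<omega>. \<omega> \<in> space P \<Longrightarrow> \<tau> n \<omega> \<in> {r..T}"
      and inc: "AE \<omega> in P. incseq (\<lambda>n. \<tau> n \<omega>)" and reach: "AE \<omega> in P. \<exists>n. \<tau> n \<omega> = T"
      and mart: "\<And>n. martingale_on P G r T (\<lambda>t \<omega>. X (min (\<tau> n \<omega>) t) \<omega>)"
    using loc by (auto simp: local_martingale_on_def)
  have meas: "X t \<in> borel_measurable (G t)" if "t \<in> {r..T}" for t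
    using loc that by (auto simp: local_martingale_on_def)
  have measP: "X t \<in> borel_measurable P" if "t \<in> {r..T}" for t
    using measurable_from_subalg[OF sub meas] that by blast
  have int: "integrable P (X t)" if "t \<in> {r..T}" for t
    using that bd by (intro integrable_const_bound[of _ B] measP) auto
  have lim: "(\<lambda>n. \<integral>\<omega>\<in>A. X (min (\<tau> n \<omega>) t) \<omega> \<partial>P) \<longlonglongrightarrow> (\<integral>\<omega>\<in>A. X t \<omega> \<partial>P)"
    if t: "t \<in> {r..T}" and A: "A \<in> sets P" for t A
    unfolding set_lebesgue_integral_def
  proof (rule integral_dominated_convergence[where w = "\<lambda>_. B"])
    show "AE \<omega> in P. (\<lambda>n. indicat_real A \<omega> *\<^sub>R X (min (\<tau> n \<omega>) t) \<omega>)
        \<longlonglongrightarrow> indicat_real A \<omega> *\<^sub>R X t \<omega>"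
      using inc reach AE_space
    proof eventually_elim
      case (elim \<omega>)
      then obtain N where N: "\<tau> N \<omega> = T" by auto
      have "\<tau> n \<omega> = T" if "n \<ge> N" for n
        using incseqD[OF elim(1) that] N \<tau>[OF elim(3), of n] by auto
      then have "\<forall>\<^sub>F n in sequentially. indicat_real A \<omega> *\<^sub>R X (min (\<tau> n \<omega>) t) \<omega>
          = indicat_real A \<omega> *\<^sub>R X t \<omega>"
        using t by (auto simp: eventually_sequentially intro!: exI[of _ N])
      then show ?case by (rule tendsto_eventually)
    qed
    show "AE \<omega> in P. norm (indicat_real A \<omega> *\<^sub>R X (min (\<tau> n \<omega>) t) \<omega>) \<le> B" for n
    proof (rule AE_I2)
      fix \<omega> assume w: "\<omega> \<in> space P"
      have "\<bar>X (min (\<tau> n \<omega>) t) \<omega>\<bar> \<le> B"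
        using bd[of "min (\<tau> n \<omega>) t" \<omega>] \<tau>[OF w, of n] t w by (auto simp: min_def)
      \<comment> \<open>The sign of \<open>B\<close> is needed off \<open>A\<close>, where the
        indicator makes the left side \<open>0\<close>.\<close>
      moreover from this have "0 \<le> B" by linarith
      ultimately show "norm (indicat_real A \<omega> *\<^sub>R X (min (\<tau> n \<omega>) t) \<omega>) \<le> B"
        by (auto simp: indicator_def)
    qed
    \<comment> \<open>Measurability at a random time does not follow from that of each
      \<open>X t\<close>; it comes from the integrability contained in
      \<open>martingale_on\<close>.\<close>
    have "(\<lambda>\<omega>. X (min (\<tau> n \<omega>) t) \<omega>) \<in> borel_measurable P" for n
      using mart[of n] t by (auto simp: martingale_on_def)
    then show "(\<lambda>\<omega>. indicat_real A \<omega> *\<^sub>R X (min (\<tau> n \<omega>) t) \<omega>) \<in> borel_measurable P" for n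
      using A by measurable
  qed (use A measP[OF t] in auto)
  have "AE \<omega> in P. real_cond_exp P (G s) (X t) \<omega> = X s \<omega>" if s: "s \<in> {r..T}" and t: "t \<in> {s..T}" for s t
  proof -
    have t': "t \<in> {r..T}" using s t by auto
    interpret finite_measure_subalgebra P "G s" by unfold_locales (rule sub[OF s])
    show ?thesis
    proof (rule real_cond_exp_charact)
      fix A assume A: "A \<in> sets (G s)"
      then have AP: "A \<in> sets P" using sub[OF s] by (auto simp: subalgebra_def)
      have "(\<integral>\<omega>\<in>A. X (min (\<tau> n \<omega>) t) \<omega> \<partial>P) = (\<integral>\<omega>\<in>A. X (min (\<tau> n \<omega>) s) \<omega> \<partial>P)" for n
      proof -
        have i: "integrable P (\<lambda>\<omega>. X (min (\<tau> n \<omega>) t) \<omega>)" "integrable P (\<lambda>\<omega>. X (min (\<tau> n \<omega>) s) \<omega>)"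
          and ae: "AE \<omega> in P. real_cond_exp P (G s) (\<lambda>\<omega>. X (min (\<tau> n \<omega>) t) \<omega>) \<omega>
            = X (min (\<tau> n \<omega>) s) \<omega>"
          using mart[of n] s t t' by (auto simp: martingale_on_def)
        have "(\<integral>\<omega>\<in>A. X (min (\<tau> n \<omega>) t) \<omega> \<partial>P)
            = (\<integral>\<omega>\<in>A. real_cond_exp P (G s) (\<lambda>\<omega>. X (min (\<tau> n \<omega>) t) \<omega>) \<omega> \<partial>P)"
          by (rule real_cond_exp_intA[OF i(1) A])
        also have "\<dots> = (\<integral>\<omega>\<in>A. X (min (\<tau> n \<omega>) s) \<omega> \<partial>P)"
          unfolding set_lebesgue_integral_def using ae AP i(2)
          by (intro integral_cong_AE) auto
        finally show ?thesis .
      qed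
      then show "(\<integral>\<omega>\<in>A. X t \<omega> \<partial>P) = (\<integral>\<omega>\<in>A. X s \<omega> \<partial>P)"
        using lim[OF t' AP] lim[OF s AP] by (simp add: LIMSEQ_unique)
    qed (use s t' int meas in auto)
  qed
  then show ?thesis using meas int by (auto simp: martingale_on_def)
qed

section \<open>Filtration, left limits and the size of the test process\<close>

lemma cadlag_process_subalgebra:
  assumes YC: "cadlag_process P r T K Y C" and t: "t \<in> {r..T}"
  shows "subalgebra P (generated_filtration P r (\<lambda>t \<omega>. (Y t \<omega>, C t \<omega>)) t)"
proof -
  let ?S = "{(\<lambda>\<omega>. (Y u \<omega>, C u \<omega>)) -` A \<inter> space P |u A. u \<in> {r..t} \<and> A \<in> sets borel}"
  have "(\<lambda>\<omega>. (Y u \<omega>, C u \<omega>)) \<in> borel_measurable P" if "u \<in> {r..t}" for u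
  proof -
    have [measurable]: "Y u \<in> borel_measurable P" "C u \<in> measurable P (count_space UNIV)"
      using YC that t by (auto simp: cadlag_process_def)
    have [measurable]: "C u \<in> borel_measurable P"
      by (rule measurable_compose[of "C u" P "count_space UNIV" "\<lambda>x. x"]) auto
    show ?thesis by measurable
  qed
  then have "?S \<subseteq> sets P" by (auto intro: measurable_sets)
  then have "sigma_sets (space P) ?S \<subseteq> sets P" by (rule sets.sigma_sets_subset)
  moreover have "?S \<subseteq> Pow (space P)" by auto
  ultimately show ?thesis
    by (simp add: subalgebra_def generated_filtration_def sets_measure_of space_measure_of)
qed

text \<open>In the discrete space \<open>nat\<close> a convergent function is eventually equal to
  its limit, so the left limit is a value that the regime takes at times in
  \<open>{r..T}\<close>.\<close>

lemma left_limit_regime: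
  fixes C :: "real \<Rightarrow> 'w \<Rightarrow> nat"
  assumes YC: "cadlag_process P r T K Y C" and w: "\<omega> \<in> space P" and u: "u \<in> {r<..T}"
  shows "left_limit (\<lambda>s. C s \<omega>) u \<in> {1..K}"
proof -
  have "\<exists>l. ((\<lambda>t. (Y t \<omega>, C t \<omega>)) \<longlongrightarrow> l) (at_left u)"
    using YC w u by (auto simp: cadlag_process_def cadlag_on_def)
  then obtain l where "((\<lambda>t. (Y t \<omega>, C t \<omega>)) \<longlongrightarrow> l) (at_left u)" ..
  from tendsto_snd[OF this] have l: "((\<lambda>t. C t \<omega>) \<longlongrightarrow> snd l) (at_left u)" by simp
  then have eq: "left_limit (\<lambda>s. C s \<omega>) u = snd l"
    unfolding left_limit_def by (intro tendsto_Lim) auto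
  have "\<forall>\<^sub>F t in at_left u. C t \<omega> = snd l"
    using l by (simp add: tendsto_discrete)
  moreover have "\<forall>\<^sub>F t in at_left u. t \<in> {r<..<u}"
    using u by (intro eventually_at_left_real) auto
  ultimately have "\<forall>\<^sub>F t in at_left u. snd l \<in> {1..K}"
  proof eventually_elim
    case (elim t)
    then have "t \<in> {r..T}" using u by simp
    then have "C t \<omega> \<in> {1..K}" using YC w unfolding cadlag_process_def by blast
    with elim(1) show ?case by simp
  qed
  \<comment> \<open>The eventual statement no longer depends on the time, and
    \<open>at_left u\<close> is a nontrivial filter, so it holds outright.\<close>
  then show ?thesis by (simp add: eq)
qed

lemma test_process_bounded:
  assumes YC: "cadlag_process P r T K Y C"
    and V: "\<And>y c. c \<in> {1..K} \<Longrightarrow> \<bar>v y c\<bar> \<le> V"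
    and B: "\<And>t y c. t \<in> {r..T} \<Longrightarrow> c \<in> {1..K} \<Longrightarrow> \<bar>\<A> t v y c\<bar> \<le> B"
    and t: "t \<in> {r..T}" and w: "\<omega> \<in> space P"
  shows "\<bar>test_process \<A> r Y C v t \<omega>\<bar> \<le> V + B * (T - r)"
proof -
  have C: "C t \<omega> \<in> {1..K}" using YC t w by (auto simp: cadlag_process_def)
  have "B \<ge> 0" using B[OF t C, of 0] by auto
  let ?g = "\<lambda>u. \<A> u v (left_limit (\<lambda>s. Y s \<omega>) u) (left_limit (\<lambda>s. C s \<omega>) u)"
  \<comment> \<open>At \<open>u = r\<close> the left limit need not be a regime and \<open>B\<close>
    need not apply, so this null point is discarded.\<close>
  have "AE u in lborel. ennreal (norm (indicat_real {r..t} u *\<^sub>R ?g u))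
      \<le> ennreal B * indicator {r..t} u"
    using AE_lborel_singleton[of r]
  proof eventually_elim
    case (elim u)
    then show ?case
      using B[of u "left_limit (\<lambda>s. C s \<omega>) u"] left_limit_regime[OF YC w, of u] t
      by (auto simp: indicator_def intro!: ennreal_leI)
  qed
  then have "norm (LINT u:{r..t}|lborel. ?g u) \<le> B * (t - r)"
    unfolding set_lebesgue_integral_def
    by (rule norm_integral_le)
      (use t \<open>B \<ge> 0\<close> in \<open>auto simp: nn_integral_cmult_indicator ennreal_mult\<close>)
  also have "\<dots> \<le> B * (T - r)" using t \<open>B \<ge> 0\<close> by (intro mult_left_mono) auto
  finally show ?thesis using V[OF C, of "Y t \<omega>"] by (auto simp: test_process_def)
qed

section \<open>Boundedness of the generator\<close>

context switching_coefficients
begin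

lemma F_section_measurable:
  assumes t: "t \<in> {0..T}" and c: "c \<in> {1..K}"
  shows "F t y c \<in> borel_measurable borel"
proof -
  have "(\<lambda>x. (t, y, c, x)) \<in> borel \<rightarrow>\<^sub>M restrict_space borel ({0..T} \<times> UNIV \<times> {1..K} \<times> UNIV)"
    using t c by (intro measurable_restrict_space2 borel_measurable_continuous_onI continuous_intros) auto
  from measurable_compose[OF this F_measurable] show ?thesis by simp
qed

text \<open>There are finitely many ordered pairs of regimes. Packing each pair into one index lets
  a single choice produce all bounds, and their sum serves every pair.\<close>

lemma lam_bound:
  obtains L where "L \<ge> 0"
    and "\<And>i j t y. i \<in> {1..K} \<Longrightarrow> j \<in> {1..K} \<Longrightarrow> i \<noteq> j \<Longrightarrow> t \<in> {0..T} \<Longrightarrow> \<bar>lam i j t y\<bar> \<le> L"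
proof -
  define I where "I = {(i, j). i \<in> {1..K} \<and> j \<in> {1..K} \<and> i \<noteq> j}"
  have fin: "finite I" by (rule finite_subset[of _ "{1..K} \<times> {1..K}"]) (auto simp: I_def)
  have "\<exists>L. \<forall>t\<in>{0..T}. \<forall>y. \<bar>lam (fst p) (snd p) t y\<bar> \<le> L" if "p \<in> I" for p
    using lam_bounded[of "fst p" "snd p"] that by (fastforce simp: I_def bounded_iff)
  then obtain L where L: "\<And>p t y. p \<in> I \<Longrightarrow> t \<in> {0..T} \<Longrightarrow> \<bar>lam (fst p) (snd p) t y\<bar> \<le> L p"
    by metis
  show thesis
  proof (rule that[of "\<Sum>p\<in>I. \<bar>L p\<bar>"])
    fix i j t y assume *: "i \<in> {1..K}" "j \<in> {1..K}" "i \<noteq> j" "t \<in> {0..T}"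
    then have "(i, j) \<in> I" by (auto simp: I_def)
    with L[of "(i, j)" t y] member_le_sum[OF this, of "\<lambda>p. \<bar>L p\<bar>"] * fin
    show "\<bar>lam i j t y\<bar> \<le> (\<Sum>p\<in>I. \<bar>L p\<bar>)" by auto
  qed (auto intro: sum_nonneg)
qed

text \<open>The final bound has one summand per term of \<open>generator\<close>. Drift and
  diffusion use the growth bound on the ball of radius \<open>S\<close>. The jump integral uses it
  at every \<open>y\<close>: its quadratic growth is cancelled by a coefficient of the squared jump
  that decays like the inverse square of \<open>norm y\<close>.\<close>

lemma generator_bounded:
  assumes K1: "K\<^sub>1 > 0"
    and growth: "\<And>t y c. t \<in> {0..T} \<Longrightarrow> c \<in> {1..K} \<Longrightarrow>
      ennreal ((norm (\<mu> t y c))\<^sup>2 + norm (\<sigma> t y c ** transpose (\<sigma> t y c)))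
        + (\<integral>\<^sup>+x\<in>{x. norm x \<le> a}. ennreal ((norm (F t y c x))\<^sup>2) \<partial>\<nu>)
      \<le> ennreal (K\<^sub>1 * (1 + (norm y)\<^sup>2))"
    and v: "v \<in> C2c K"
  obtains B where "\<And>t y c. t \<in> {0..T} \<Longrightarrow> c \<in> {1..K} \<Longrightarrow>
    \<bar>generator a K \<nu> \<mu> \<sigma> F \<rho> lam t v y c\<bar> \<le> B"
proof -
  obtain R V where R: "R \<ge> 0" and V0: "V \<ge> 0"
    and C2: "\<And>k. k \<in> {1..K} \<Longrightarrow> C2 (\<lambda>z. v z k)"
    and V: "\<And>k y. k \<in> {1..K} \<Longrightarrow> \<bar>v y k\<bar> \<le> V"
    and Vg: "\<And>k y. k \<in> {1..K} \<Longrightarrow> norm (grad (\<lambda>z. v z k) y) \<le> V"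
    and Vh: "\<And>k y. k \<in> {1..K} \<Longrightarrow> norm (hess (\<lambda>z. v z k) y) \<le> V"
    and out: "\<And>k y. k \<in> {1..K} \<Longrightarrow> norm y > R \<Longrightarrow>
      v y k = 0 \<and> grad (\<lambda>z. v z k) y = 0 \<and> hess (\<lambda>z. v z k) y = 0"
    using C2c_bounds[OF v] by metis
  obtain L where L0: "L \<ge> 0" and L: "\<And>i j t y. i \<in> {1..K} \<Longrightarrow> j \<in> {1..K} \<Longrightarrow> i \<noteq> j \<Longrightarrow>
      t \<in> {0..T} \<Longrightarrow> \<bar>lam i j t y\<bar> \<le> L"
    using lam_bound by metis
  obtain N where N0: "N \<ge> 0" and N: "emeasure \<nu> {x. norm x > a} = ennreal N"
    using levy_measure_large_jumps[OF levy a_pos] less_top_ennreal by auto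
  have sets[measurable_cong]: "sets \<nu> = sets borel"
    using levy by (simp add: levy_measure_def)
  \<comment> \<open>Beyond \<open>S\<close> the point is off the support, more than
    \<open>2 * R\<close> from the origin, and of norm at least \<open>1\<close>. \<open>Q\<close> is
    the growth bound at radius \<open>S\<close>. \<open>J\<close> bounds the small jumps: its first
    entry is for \<open>norm y \<le> S\<close>, its second for larger \<open>y\<close>.\<close>
  define S where "S = 2 * R + 1"
  define Q where "Q = K\<^sub>1 * (1 + S\<^sup>2)"
  define n where "n = real CARD('d)"
  define J where "J = max (n * (n * V) * Q) (8 * K\<^sub>1 * V)"
  have S: "S \<ge> 1" "S \<ge> R" using R by (auto simp: S_def)
  have Q0: "Q \<ge> 0" using K1 by (simp add: Q_def)
  have J0: "J \<ge> 0" using K1 V0 by (simp add: J_def le_max_iff_disj)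
  have "\<bar>generator a K \<nu> \<mu> \<sigma> F \<rho> lam t v y c\<bar>
      \<le> V * (Q + 1) + n * (n * (Q * V)) + (J + 2 * V * N) + real K * (2 * V * L)"
    if t: "t \<in> {0..T}" and c: "c \<in> {1..K}" for t y c
  proof -
    have small: "(norm (\<mu> t y c))\<^sup>2 \<le> Q" "norm (\<sigma> t y c ** transpose (\<sigma> t y c)) \<le> Q"
      if "norm y \<le> S"
    proof -
      have "ennreal ((norm (\<mu> t y c))\<^sup>2 + norm (\<sigma> t y c ** transpose (\<sigma> t y c)))
          \<le> ennreal (K\<^sub>1 * (1 + (norm y)\<^sup>2))"
        using growth[OF t c, of y] by (rule order.trans[rotated]) simp
      then have "(norm (\<mu> t y c))\<^sup>2 + norm (\<sigma> t y c ** transpose (\<sigma> t y c)) \<le> K\<^sub>1 * (1 + (norm y)\<^sup>2)"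
        using K1 by (subst (asm) ennreal_le_iff) auto
      also have "\<dots> \<le> Q" using K1 that by (auto simp: Q_def intro!: power_mono)
      finally show "(norm (\<mu> t y c))\<^sup>2 \<le> Q" "norm (\<sigma> t y c ** transpose (\<sigma> t y c)) \<le> Q"
        using norm_ge_zero[of "\<sigma> t y c ** transpose (\<sigma> t y c)"] zero_le_power2[of "norm (\<mu> t y c)"]
        by linarith+
    qed
    have drift: "\<bar>grad (\<lambda>z. v z c) y \<bullet> \<mu> t y c\<bar> \<le> V * (Q + 1)"
    proof (cases "norm y \<le> S")
      case True
      \<comment> \<open>Growth controls the square of the drift; this inequality gives
        \<open>2 * norm (\<mu> t y c) \<le> Q + 1\<close> without a square root.\<close>
      have "0 \<le> (norm (\<mu> t y c) - 1)\<^sup>2" by simp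
      then have "norm (\<mu> t y c) \<le> Q + 1"
        using small(1)[OF True] Q0
        by (simp add: power2_diff)
      then have "norm (grad (\<lambda>z. v z c) y) * norm (\<mu> t y c) \<le> V * (Q + 1)"
        using Vg[OF c] V0 by (intro mult_mono) auto
      then show ?thesis using Cauchy_Schwarz_ineq2 order_trans by blast
    next
      case False
      then show ?thesis using out[OF c, of y] S V0 Q0 by simp
    qed
    have diffusion: "\<bar>1 / 2 * trace (\<sigma> t y c ** transpose (\<sigma> t y c) ** hess (\<lambda>z. v z c) y)\<bar>
        \<le> n * (n * (Q * V))"
    proof (cases "norm y \<le> S")
      case True
      have "\<bar>trace (\<sigma> t y c ** transpose (\<sigma> t y c) ** hess (\<lambda>z. v z c) y)\<bar>
          \<le> n * (n * (norm (\<sigma> t y c ** transpose (\<sigma> t y c)) * norm (hess (\<lambda>z. v z c) y)))"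
        unfolding n_def by (rule abs_trace_mult_le)
      also have "\<dots> \<le> n * (n * (Q * V))"
        using small(2)[OF True] Vh[OF c] Q0 by (intro mult_left_mono mult_mono) (auto simp: n_def)
      finally show ?thesis by simp
    next
      case False
      then have "hess (\<lambda>z. v z c) y = 0" using out[OF c, of y] S by simp
      then show ?thesis using V0 Q0 by (simp add: n_def trace_def matrix_matrix_mult_def)
    qed
    have jumps: "\<bar>\<integral>x. (v (y + F t y c x) c - v y c
        - (grad (\<lambda>z. v z c) y \<bullet> F t y c x) * indicator {x. norm x \<le> a} x) \<partial>\<nu>\<bar> \<le> J + 2 * V * N"
    proof -
      have [measurable]: "F t y c \<in> borel_measurable \<nu>"
        using F_section_measurable[OF t c] by (simp add: measurable_cong_sets[OF sets refl])
      \<comment> \<open>Beyond \<open>2 * R + 1\<close> a jump back to the support has norm at least \<open>norm y / 2\<close>.\<close>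
      define D where "D = (if norm y \<le> S then n * (n * V) else 4 * V / (norm y)\<^sup>2)"
      have D0: "D \<ge> 0" using V0 by (simp add: D_def n_def)
      have D: "\<bar>v (y + h) c - v y c - grad (\<lambda>z. v z c) y \<bullet> h\<bar> \<le> D * (norm h)\<^sup>2" for h
      proof (cases "norm y \<le> S")
        case True
        then show ?thesis
          using second_order_remainder[OF C2[OF c] Vh[OF c], of y h] by (simp add: D_def n_def)
      next
        case False
        then have z: "v y c = 0" "grad (\<lambda>z. v z c) y = 0" and y: "norm y > 0" "norm y > 2 * R"
          using out[OF c, of y] S by (auto simp: S_def)
        show ?thesis
        proof (cases "norm (y + h) > R")
          case True
          then show ?thesis using z out[OF c, of "y + h"] D0 by simp
        next
          case far: False
          have "norm y \<le> norm (y + h) + norm h"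
            using norm_triangle_ineq4[of "y + h" h] by simp
          \<comment> \<open>The landing point has norm at most \<open>R\<close>, which is less than
            \<open>norm y / 2\<close>.\<close>
          then have "norm y / 2 \<le> norm h" using far y by simp
          then have "(norm y / 2)\<^sup>2 \<le> (norm h)\<^sup>2" by (intro power_mono) auto
          then have "1 \<le> 4 / (norm y)\<^sup>2 * (norm h)\<^sup>2" using y by (simp add: field_simps)
          then have "V * 1 \<le> V * (4 / (norm y)\<^sup>2 * (norm h)\<^sup>2)" by (rule mult_left_mono[OF _ V0])
          with V[OF c, of "y + h"] show ?thesis
            using False z by (simp add: D_def algebra_simps)
        qed
      qed
      \<comment> \<open>Far out, \<open>1 \<le> (norm y)\<^sup>2\<close> absorbs the constant
        \<open>1\<close> at the price of a factor \<open>2\<close>; with the \<open>4\<close> in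
        \<open>D\<close> this gives the \<open>8\<close> in \<open>J\<close>.\<close>
      have DJ: "D * (K\<^sub>1 * (1 + (norm y)\<^sup>2)) \<le> J"
      proof (cases "norm y \<le> S")
        case True
        then have "K\<^sub>1 * (1 + (norm y)\<^sup>2) \<le> Q" using K1 by (auto simp: Q_def intro!: power_mono)
        then have "n * (n * V) * (K\<^sub>1 * (1 + (norm y)\<^sup>2)) \<le> n * (n * V) * Q"
          using V0 by (intro mult_left_mono) (auto simp: n_def)
        with True show ?thesis by (simp add: D_def J_def)
      next
        case False
        then have "1 \<le> (norm y)\<^sup>2" using S by (simp add: one_le_power)
        then have "4 * V / (norm y)\<^sup>2 * (K\<^sub>1 * (1 + (norm y)\<^sup>2))
            \<le> 4 * V / (norm y)\<^sup>2 * (K\<^sub>1 * ((norm y)\<^sup>2 + (norm y)\<^sup>2))"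
          using V0 K1 by (intro mult_left_mono) auto
        also have "\<dots> = 8 * K\<^sub>1 * V" using \<open>1 \<le> (norm y)\<^sup>2\<close> by (auto simp: field_simps)
        finally show ?thesis using False by (simp add: D_def J_def)
      qed
      \<comment> \<open>Small jumps are dominated through the remainder bound \<open>D\<close>.
        Large jumps carry no compensator, so there the difference of two values of \<open>v\<close>
        is at most \<open>2 * V\<close>.\<close>
      let ?g = "\<lambda>x. ennreal D * (ennreal ((norm (F t y c x))\<^sup>2) * indicator {x. norm x \<le> a} x)
        + ennreal (2 * V) * indicator {x. norm x > a} x"
      have dom: "ennreal (norm (v (y + F t y c x) c - v y c
          - (grad (\<lambda>z. v z c) y \<bullet> F t y c x) * indicator {x. norm x \<le> a} x)) \<le> ?g x" for x
      proof (cases "norm x \<le> a")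
        case True
        then show ?thesis using D[of "F t y c x"] D0
          by (auto simp: ennreal_mult[symmetric] intro!: ennreal_leI)
      next
        case False
        then show ?thesis using V[OF c, of y] V[OF c, of "y + F t y c x"]
          by (auto intro!: ennreal_leI)
      qed
      have F2: "(\<integral>\<^sup>+x\<in>{x. norm x \<le> a}. ennreal ((norm (F t y c x))\<^sup>2) \<partial>\<nu>)
          \<le> ennreal (K\<^sub>1 * (1 + (norm y)\<^sup>2))"
        using growth[OF t c, of y] by (rule order.trans[rotated]) simp
      have "(\<integral>\<^sup>+x. ?g x \<partial>\<nu>)
          = ennreal D * (\<integral>\<^sup>+x\<in>{x. norm x \<le> a}. ennreal ((norm (F t y c x))\<^sup>2) \<partial>\<nu>)
            + ennreal (2 * V) * emeasure \<nu> {x. norm x > a}"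
        by (subst nn_integral_add)
          (auto simp: nn_integral_cmult nn_integral_cmult_indicator sets)
      also have "\<dots> \<le> ennreal D * ennreal (K\<^sub>1 * (1 + (norm y)\<^sup>2)) + ennreal (2 * V) * ennreal N"
        unfolding N by (intro add_mono mult_left_mono F2) auto
      also have "\<dots> = ennreal (D * (K\<^sub>1 * (1 + (norm y)\<^sup>2)) + 2 * V * N)"
        using D0 K1 V0 N0 by (simp add: ennreal_mult ennreal_plus)
      also have "\<dots> \<le> ennreal (J + 2 * V * N)"
        using DJ by (intro ennreal_leI) simp
      finally show ?thesis
        unfolding real_norm_def[symmetric]
        by (rule norm_integral_le[OF AE_I2[OF dom]]) (use J0 V0 N0 in simp)
    qed
    have switch: "\<bar>\<Sum>k\<in>{1..K} - {c}. (v (y + \<rho> c k t y) k - v y c) * lam c k t y\<bar> \<le> real K * (2 * V * L)"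
    proof -
      \<comment> \<open>Wherever the switch lands, both values of \<open>v\<close> are at most
        \<open>V\<close> in absolute value.\<close>
      have "\<bar>(v (y + \<rho> c k t y) k - v y c) * lam c k t y\<bar> \<le> 2 * V * L" if "k \<in> {1..K} - {c}" for k
        using V[OF c, of y] V[of k "y + \<rho> c k t y"] L[OF c, of k t y] that t V0
        unfolding abs_mult by (intro mult_mono) auto
      then have "\<bar>\<Sum>k\<in>{1..K} - {c}. (v (y + \<rho> c k t y) k - v y c) * lam c k t y\<bar>
          \<le> (\<Sum>k\<in>{1..K} - {c}. 2 * V * L)"
        by (intro order.trans[OF sum_abs] sum_mono)
      also have "\<dots> = real (card ({1..K} - {c})) * (2 * V * L)" by simp
      also have "\<dots> \<le> real K * (2 * V * L)"
        using V0 L0 c by (intro mult_right_mono) auto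
      finally show ?thesis .
    qed
    show ?thesis
      unfolding generator_def using drift diffusion jumps switch by linarith
  qed
  then show thesis by (rule that)
qed

end

section \<open>From the local martingale problem to the martingale problem\<close>

theorem theorem5p1:
  fixes T a r K\<^sub>1 :: real
    and K :: nat
    and \<nu> :: "(real ^ 'n) measure"
    and \<mu> :: "real \<Rightarrow> real ^ 'd \<Rightarrow> nat \<Rightarrow> real ^ 'd"
    and \<sigma> :: "real \<Rightarrow> real ^ 'd \<Rightarrow> nat \<Rightarrow> real ^ 'p ^ 'd"
    and F :: "real \<Rightarrow> real ^ 'd \<Rightarrow> nat \<Rightarrow> real ^ 'n \<Rightarrow> real ^ 'd"
    and \<rho> :: "nat \<Rightarrow> nat \<Rightarrow> real \<Rightarrow> real ^ 'd \<Rightarrow> real ^ 'd"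
    and lam :: "nat \<Rightarrow> nat \<Rightarrow> real \<Rightarrow> real ^ 'd \<Rightarrow> real"
    and P :: "'w measure"
    and Y :: "real \<Rightarrow> 'w \<Rightarrow> real ^ 'd"
    and C :: "real \<Rightarrow> 'w \<Rightarrow> nat"
  assumes coefficients: "switching_coefficients T a K \<nu> \<mu> \<sigma> F \<rho> lam"
    and r: "0 \<le> r" "r < T"
    and P: "prob_space P"
    and YC: "cadlag_process P r T K Y C"
    and local_solution:
      "solves_local_martingale_problem K (generator a K \<nu> \<mu> \<sigma> F \<rho> lam) P r T Y C"
    and K\<^sub>1: "K\<^sub>1 > 0"
    and growth: "\<And>t y c. t \<in> {0..T} \<Longrightarrow> c \<in> {1..K} \<Longrightarrow>
      ennreal ((norm (\<mu> t y c))\<^sup>2 + norm (\<sigma> t y c ** transpose (\<sigma> t y c)))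
        + (\<integral>\<^sup>+x\<in>{x. norm x \<le> a}. ennreal ((norm (F t y c x))\<^sup>2) \<partial>\<nu>)
      \<le> ennreal (K\<^sub>1 * (1 + (norm y)\<^sup>2))"
    and alternatives:
      "(\<exists>K\<^sub>3::real. \<forall>t\<in>{0..T}. \<forall>y. \<forall>c\<in>{1..K}. \<forall>k\<in>{1..K}. k \<noteq> c \<longrightarrow>
          (\<integral>\<^sup>+x\<in>{x. norm x > a}. ennreal ((norm (F t y c x))\<^sup>2) \<partial>\<nu>)
            + ennreal ((norm (\<rho> c k t y))\<^sup>2)
          \<le> ennreal (K\<^sub>3 * (1 + (norm y)\<^sup>2)))
       \<or> (\<exists>M::real. \<forall>t\<in>{0..T}. \<forall>y. \<forall>c\<in>{1..K}.
          (\<integral>\<^sup>+x\<in>{x. norm x \<le> 1}. ennreal ((norm (F t y c x))\<^sup>2) \<partial>\<nu>) \<le> ennreal M)"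
  shows "solves_martingale_problem K (generator a K \<nu> \<mu> \<sigma> F \<rho> lam) P r T Y C"
  unfolding solves_martingale_problem_def
proof
  interpret switching_coefficients T a K \<nu> \<mu> \<sigma> F \<rho> lam by fact
  fix v :: "real ^ 'd \<Rightarrow> nat \<Rightarrow> real" assume v: "v \<in> C2c K"
  let ?X = "test_process (generator a K \<nu> \<mu> \<sigma> F \<rho> lam) r Y C v"
  obtain B where B: "\<And>t y c. t \<in> {0..T} \<Longrightarrow> c \<in> {1..K} \<Longrightarrow>
      \<bar>generator a K \<nu> \<mu> \<sigma> F \<rho> lam t v y c\<bar> \<le> B"
    using generator_bounded[OF K\<^sub>1 growth v] by blast
  obtain V where V: "\<And>y c. c \<in> {1..K} \<Longrightarrow> \<bar>v y c\<bar> \<le> V"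
    using C2c_bounds[OF v] by metis
  show "martingale_on P (generated_filtration P r (\<lambda>t \<omega>. (Y t \<omega>, C t \<omega>))) r T ?X"
  proof (rule bounded_local_martingale_imp_martingale[OF P])
    show "local_martingale_on P (generated_filtration P r (\<lambda>t \<omega>. (Y t \<omega>, C t \<omega>))) r T ?X"
      using local_solution v by (simp add: solves_local_martingale_problem_def)
    \<comment> \<open>This bound is deterministic and uniform in \<open>t\<close>, so it also
      dominates the values at the localizing times.\<close>
    show "\<bar>?X t \<omega>\<bar> \<le> V + B * (T - r)" if "t \<in> {r..T}" "\<omega> \<in> space P" for t \<omega>
    proof (rule test_process_bounded[where K = K])
      show "\<bar>generator a K \<nu> \<mu> \<sigma> F \<rho> lam u v y c\<bar> \<le> B"
        if "u \<in> {r..T}" "c \<in> {1..K}" for u y c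
        using that r by (intro B) auto
    qed (use YC V that in auto)
  qed (rule cadlag_process_subalgebra[OF YC])
qed

end
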